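(* Consider the following three discrete update maps $(\mathbf\Xi^n,\mathbf V^n,\mathbf e^n,\mathbf b^n)\mapsto(\mathbf\Xi^{n+1},\mathbf V^{n+1},\mathbf e^{n+1},\mathbf b^{n+1})$ with time step $\Delta t$, where $t^{n+1}=t^n+\Delta t$. (E) $\mathbf\Xi^{n+1}=\mathbf\Xi^n$, $\mathbf V^{n+1}=\mathbf V^n+\Delta t\,\mathbb M_m^{-1}\mathbb M_q\mathbb N(\mathbf\Xi^n)\mathbb L^1(\mathbf\Xi^n)\mathbf e^n$, $\mathbf e^{n+1}=\mathbf e^n$, $\mathbf b^{n+1}=\mathbf b^n-\Delta t\,\mathsf C\mathbf e^n$. (B) $\mathbf\Xi^{n+1}=\mathbf\Xi^n$, $\mathbf V^{n+1}=\mathbf V^n$, $\tilde{\mathsf M}_1\mathbf e^{n+1}=\tilde{\mathsf M}_1\mathbf e^n+\Delta t\,\mathsf C^\top\tilde{\mathsf M}_2\mathbf b^n$, $\mathbf b^{n+1}=\mathbf b^n$. (P) With $\overline{\mathbf\Xi}=\frac{\mathbf\Xi^n+\mathbf\Xi^{n+1}}2$, $\overline{\mathbf V}=\frac{\mathbf V^n+\mathbf V^{n+1}}2$ and $\mathbf\Xi(\tau)=\frac{(t^{n+1}-\tau)\mathbf\Xi^n+(\tau-t^n)\mathbf\Xi^{n+1}}{\Delta t}$, the new state satisfies $$\mathbf\Xi^{n+1}=\mathbf\Xi^n+\Delta t\,\mathbb N(\overline{\mathbf\Xi})^\top\overline{\mathbf V},$$ $$\mathbf V^{n+1}=\mathbf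 V^n+\Delta t\,\mathbb M_m^{-1}\mathbb M_q\mathbb N(\overline{\mathbf\Xi})\tilde{\mathbb B}(\overline{\mathbf\Xi},\mathbf b^n)\mathbb N(\overline{\mathbf\Xi})^\top\overline{\mathbf V},$$ $$\tilde{\mathsf M}_1\mathbf e^{n+1}=\tilde{\mathsf M}_1\mathbf e^n-\int_{t^n}^{t^{n+1}}\mathbb L^1(\mathbf\Xi(\tau))^\top d\tau\;\mathbb M_q\,\mathbb N(\overline{\mathbf\Xi})^\top\overline{\mathbf V},\qquad \mathbf b^{n+1}=\mathbf b^n.$$ For the splitting scheme that advances the state by successive application of the updates (E), (B), (P), the discrete electric Gauss law $$\mathsf G^\top\tilde{\mathsf M}_1\mathbf e=-\mathbb L^0(\mathbf\Xi)^\top\mathbb M_q^0\,\mathbb 1_{N_p}$$ is preserved over time if it is satisfied initially: if it holds for the initial state, it holds for every state produced by the scheme.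
   Context: Geometry: $\tilde\Omega=[0,1]^3$ and $F:\tilde\Omega\to\Omega\subset\mathbb R^3$ is a smooth bijection with $J_F(\xi)=\det DF(\xi)\neq0$ for all $\xi$. Put $N(\xi)=DF(\xi)^{-\top}$, $G_n=N^\top N$, $G_t=DF^\top DF$. Discrete de Rham sequence on $\tilde\Omega$: there are linearly independent families of basis functions, collected in rows: $\tilde\Lambda^0(\xi)\in\mathbb R^{1\times N_0}$, $\tilde{\mathbf\Lambda}^1(\xi)\in\mathbb R^{3\times3N_1}$, $\tilde{\mathbf\Lambda}^2(\xi)\in\mathbb R^{3\times3N_2}$, $\tilde\Lambda^3(\xi)\in\mathbb R^{1\times N_3}$, and constant matrices $\mathsf G\in\mathbb R^{3N_1\times N_0}$, $\mathsf C\in\mathbb R^{3N_2\times3N_1}$, $\mathsf D\in\mathbb R^{N_3\times3N_2}$ such that (columnwise) $\nabla\tilde\Lambda^0=\tilde{\mathbf\Lambda}^1\mathsf G$, $\nabla\times\tilde{\mathbf\Lambda}^1=\tilde{\mathbf\Lambda}^2\mathsf C$, $\nabla\cdot\tilde{\mathbf\Lambda}^2=\tilde\Lambda^3\mathsf D$, with $\mathsf D\mathsf C=0$, $\mathsf C\mathsf G=0$. Basis functions are assumed smooth enough that these derivatives exist classically and the chain rule applies. Mass matrices: $\tilde{\mathsf M}_1=\int_{\tilde\Omega}(\tilde{\mathbf\Lambda}^1)^\top G_n\tilde{\mathbf\Lambda}^1|J_F|\,d\xi$, $\tilde{\mathsf M}_2=\int_{\tilde\Omega}(\tilde{\mathbf\Lambda}^2)^\top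 G_t\tilde{\mathbf\Lambda}^2\frac1{|J_F|}\,d\xi$ (symmetric positive definite). Particles: $N_p$ particles with logical positions $\xi_p\in\tilde\Omega$, velocities $v_p\in\mathbb R^3$, constant weights $\omega_p>0$, masses $m_p>0$, charges $q_p$. $\mathbf\Xi=(\xi_1,\dots,\xi_{N_p})$, $\mathbf V=(v_1,\dots,v_{N_p})$; $\mathbf e\in\mathbb R^{3N_1}$, $\mathbf b\in\mathbb R^{3N_2}$ are the field coefficients. $\mathbb M_m=\mathrm{diag}(\omega_pm_p)\otimes\mathbb I_3$, $\mathbb M_q=\mathrm{diag}(\omega_pq_p)\otimes\mathbb I_3$, $\mathbb M^0_q=\mathrm{diag}(\omega_pq_p)\in\mathbb R^{N_p\times N_p}$; $\mathbb N(\mathbf\Xi)$ is block diagonal with blocks $N(\xi_p)$; $\mathbb L^0(\mathbf\Xi)\in\mathbb R^{N_p\times N_0}$ has rows $\tilde\Lambda^0(\xi_p)$; $\mathbb L^1(\mathbf\Xi)\in\mathbb R^{3N_p\times3N_1}$ is obtained by stacking the blocks $\tilde{\mathbf\Lambda}^1(\xi_p)$; $\tilde{\mathbb B}(\mathbf\Xi,\mathbf b)$ is block diagonal with $p$-th block the matrix of $w\mapsto w\times\tilde{\mathbf\Lambda}^2(\xi_p)\mathbf b$; $\mathbb 1_{N_p}$ is the all-ones vector. The updates may be composed in any order, each substep possibly with its own step size; it is assumed that the implicit update (P) has a solution with positions in $\tilde\Omega$ and that the scheme uses such a solution. *)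

theory Defs
  imports "HOL-Analysis.Analysis"
begin

section \<open>Calculus on the logical domain\<close>

abbreviation logical_domain :: "(real^3) set" where
  "logical_domain \<equiv> cbox 0 1"

text \<open>All derivatives are taken within the closed cube, so they are one-sided on its boundary.
  They are unique there, and values of the functions outside the cube play no role.\<close>

primrec Ck_on :: "nat \<Rightarrow> 'a::real_normed_vector set \<Rightarrow> ('a \<Rightarrow> 'b::real_normed_vector) \<Rightarrow> bool" where
  "Ck_on 0 S f \<longleftrightarrow> continuous_on S f"
| "Ck_on (Suc k) S f \<longleftrightarrow>
     f differentiable_on S \<and> (\<forall>v. Ck_on k S (\<lambda>x. frechet_derivative f (at x within S) v))"

definition smooth_on :: "'a::real_normed_vector set \<Rightarrow> ('a \<Rightarrow> 'b::real_normed_vector) \<Rightarrow> bool" where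
  "smooth_on S f \<longleftrightarrow> (\<forall>k. Ck_on k S f)"

definition partial :: "3 \<Rightarrow> (real^3 \<Rightarrow> real) \<Rightarrow> real^3 \<Rightarrow> real" where
  "partial i f \<xi> = frechet_derivative f (at \<xi> within logical_domain) (axis i 1)"

definition grad :: "(real^3 \<Rightarrow> real) \<Rightarrow> real^3 \<Rightarrow> real^3" where
  "grad f \<xi> = (\<chi> i. partial i f \<xi>)"

definition curl :: "(real^3 \<Rightarrow> real^3) \<Rightarrow> real^3 \<Rightarrow> real^3" where
  "curl u \<xi> = vector
     [partial 2 (\<lambda>x. u x $ 3) \<xi> - partial 3 (\<lambda>x. u x $ 2) \<xi>,
      partial 3 (\<lambda>x. u x $ 1) \<xi> - partial 1 (\<lambda>x. u x $ 3) \<xi>,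
      partial 1 (\<lambda>x. u x $ 2) \<xi> - partial 2 (\<lambda>x. u x $ 1) \<xi>]"

definition divergence :: "(real^3 \<Rightarrow> real^3) \<Rightarrow> real^3 \<Rightarrow> real" where
  "divergence u \<xi> = (\<Sum>i\<in>UNIV. partial i (\<lambda>x. u x $ i) \<xi>)"

definition grad_cols :: "(real^3 \<Rightarrow> real^'n^1) \<Rightarrow> real^3 \<Rightarrow> real^'n^3" where
  "grad_cols \<Lambda> \<xi> = (\<chi> i j. grad (\<lambda>x. \<Lambda> x $ 1 $ j) \<xi> $ i)"

definition curl_cols :: "(real^3 \<Rightarrow> real^'n^3) \<Rightarrow> real^3 \<Rightarrow> real^'n^3" where
  "curl_cols \<Lambda> \<xi> = (\<chi> i j. curl (\<lambda>x. column j (\<Lambda> x)) \<xi> $ i)"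

definition div_cols :: "(real^3 \<Rightarrow> real^'n^3) \<Rightarrow> real^3 \<Rightarrow> real^'n^1" where
  "div_cols \<Lambda> \<xi> = (\<chi> i j. divergence (\<lambda>x. column j (\<Lambda> x)) \<xi>)"

section \<open>Geometry\<close>

definition DF :: "(real^3 \<Rightarrow> real^3) \<Rightarrow> real^3 \<Rightarrow> real^3^3" where
  "DF F \<xi> = matrix (frechet_derivative F (at \<xi> within logical_domain))"

definition JF :: "(real^3 \<Rightarrow> real^3) \<Rightarrow> real^3 \<Rightarrow> real" where
  "JF F \<xi> = det (DF F \<xi>)"

definition Nmat :: "(real^3 \<Rightarrow> real^3) \<Rightarrow> real^3 \<Rightarrow> real^3^3" where
  "Nmat F \<xi> = transpose (matrix_inv (DF F \<xi>))"

definition Gn :: "(real^3 \<Rightarrow> real^3) \<Rightarrow> real^3 \<Rightarrow> real^3^3" where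
  "Gn F \<xi> = transpose (Nmat F \<xi>) ** Nmat F \<xi>"

definition Gt :: "(real^3 \<Rightarrow> real^3) \<Rightarrow> real^3 \<Rightarrow> real^3^3" where
  "Gt F \<xi> = transpose (DF F \<xi>) ** DF F \<xi>"

definition coordinate_map :: "(real^3 \<Rightarrow> real^3) \<Rightarrow> (real^3) set \<Rightarrow> bool" where
  "coordinate_map F \<Omega> \<longleftrightarrow>
     smooth_on logical_domain F \<and> bij_betw F logical_domain \<Omega> \<and>
     (\<forall>\<xi>\<in>logical_domain. JF F \<xi> \<noteq> 0)"

section \<open>Discrete de Rham sequence\<close>

text \<open>The \<open>3N\<^sub>1\<close> and \<open>3N\<^sub>2\<close> basis functions are indexed by the types \<open>'n1 \<times> 3\<close> and \<open>'n2 \<times> 3\<close>.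
  A matrix with \<open>r\<close> rows and \<open>c\<close> columns has type \<open>real^c^r\<close>.\<close>

definition independent_columns :: "(real^3 \<Rightarrow> real^'n^'r) \<Rightarrow> bool" where
  "independent_columns \<Lambda> \<longleftrightarrow> (\<forall>c. (\<forall>\<xi>\<in>logical_domain. \<Lambda> \<xi> *v c = 0) \<longrightarrow> c = 0)"

definition discrete_de_rham ::
  "(real^3 \<Rightarrow> real^'n0^1) \<Rightarrow> (real^3 \<Rightarrow> real^('n1::finite \<times> 3)^3) \<Rightarrow>
   (real^3 \<Rightarrow> real^('n2::finite \<times> 3)^3) \<Rightarrow> (real^3 \<Rightarrow> real^'n3^1) \<Rightarrow>
   real^'n0^('n1::finite \<times> 3) \<Rightarrow> real^('n1::finite \<times> 3)^('n2::finite \<times> 3) \<Rightarrow> real^('n2::finite \<times> 3)^'n3 \<Rightarrow> bool" where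
  "discrete_de_rham \<Lambda>0 \<Lambda>1 \<Lambda>2 \<Lambda>3 G C D \<longleftrightarrow>
     independent_columns \<Lambda>0 \<and> independent_columns \<Lambda>1 \<and>
     independent_columns \<Lambda>2 \<and> independent_columns \<Lambda>3 \<and>
     \<Lambda>0 differentiable_on logical_domain \<and>
     \<Lambda>1 differentiable_on logical_domain \<and>
     \<Lambda>2 differentiable_on logical_domain \<and>
     (\<forall>\<xi>\<in>logical_domain. grad_cols \<Lambda>0 \<xi> = \<Lambda>1 \<xi> ** G) \<and>
     (\<forall>\<xi>\<in>logical_domain. curl_cols \<Lambda>1 \<xi> = \<Lambda>2 \<xi> ** C) \<and>
     (\<forall>\<xi>\<in>logical_domain. div_cols \<Lambda>2 \<xi> = \<Lambda>3 \<xi> ** D) \<and>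
     D ** C = 0 \<and> C ** G = 0"

definition mass1 :: "(real^3 \<Rightarrow> real^3) \<Rightarrow> (real^3 \<Rightarrow> real^'n^3) \<Rightarrow> real^'n^'n" where
  "mass1 F \<Lambda>1 = integral logical_domain
     (\<lambda>\<xi>. \<bar>JF F \<xi>\<bar> *\<^sub>R (transpose (\<Lambda>1 \<xi>) ** Gn F \<xi> ** \<Lambda>1 \<xi>))"

definition mass2 :: "(real^3 \<Rightarrow> real^3) \<Rightarrow> (real^3 \<Rightarrow> real^'n^3) \<Rightarrow> real^'n^'n" where
  "mass2 F \<Lambda>2 = integral logical_domain
     (\<lambda>\<xi>. (1 / \<bar>JF F \<xi>\<bar>) *\<^sub>R (transpose (\<Lambda>2 \<xi>) ** Gt F \<xi> ** \<Lambda>2 \<xi>))"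

section \<open>Particles\<close>

text \<open>A vector in \<open>\<real>\<close> to the power \<open>3N\<^sub>p\<close> is indexed by \<open>'p \<times> 3\<close>: the entry \<open>(p, k)\<close> is the
  \<open>k\<close>-th component of the \<open>p\<close>-th particle.\<close>

definition blk :: "real^('p::finite \<times> 3) \<Rightarrow> 'p \<Rightarrow> real^3" where
  "blk X p = (\<chi> k. X $ (p, k))"

definition diag :: "('a \<Rightarrow> real) \<Rightarrow> real^'a^'a" where
  "diag d = (\<chi> i j. if i = j then d i else 0)"

definition kron :: "real^'b^'a \<Rightarrow> real^'d^'c \<Rightarrow> real^('b::finite \<times> 'd::finite)^('a::finite \<times> 'c::finite)" where
  "kron A B = (\<chi> i j. A $ fst i $ fst j * B $ snd i $ snd j)"

definition block_diag :: "('p \<Rightarrow> real^3^3) \<Rightarrow> real^('p::finite \<times> 3)^('p::finite \<times> 3)" where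
  "block_diag A = (\<chi> i j. if fst i = fst j then A (fst i) $ snd i $ snd j else 0)"

definition Mm :: "('p::finite \<Rightarrow> real) \<Rightarrow> ('p \<Rightarrow> real) \<Rightarrow> real^('p::finite \<times> 3)^('p::finite \<times> 3)" where
  "Mm \<omega> m = kron (diag (\<lambda>p. \<omega> p * m p)) (mat 1)"

definition Mq :: "('p::finite \<Rightarrow> real) \<Rightarrow> ('p \<Rightarrow> real) \<Rightarrow> real^('p::finite \<times> 3)^('p::finite \<times> 3)" where
  "Mq \<omega> q = kron (diag (\<lambda>p. \<omega> p * q p)) (mat 1)"

definition Mq0 :: "('p::finite \<Rightarrow> real) \<Rightarrow> ('p \<Rightarrow> real) \<Rightarrow> real^'p^'p" where
  "Mq0 \<omega> q = diag (\<lambda>p. \<omega> p * q p)"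

definition NN :: "(real^3 \<Rightarrow> real^3) \<Rightarrow> real^('p::finite \<times> 3) \<Rightarrow> real^('p::finite \<times> 3)^('p::finite \<times> 3)" where
  "NN F X = block_diag (\<lambda>p. Nmat F (blk X p))"

definition LL0 :: "(real^3 \<Rightarrow> real^'n^1) \<Rightarrow> real^('p::finite \<times> 3) \<Rightarrow> real^'n^'p" where
  "LL0 \<Lambda>0 X = (\<chi> p. \<Lambda>0 (blk X p) $ 1)"

definition LL1 :: "(real^3 \<Rightarrow> real^'n^3) \<Rightarrow> real^('p::finite \<times> 3) \<Rightarrow> real^'n^('p::finite \<times> 3)" where
  "LL1 \<Lambda>1 X = (\<chi> i. \<Lambda>1 (blk X (fst i)) $ snd i)"

definition BB :: "(real^3 \<Rightarrow> real^'n^3) \<Rightarrow> real^('p::finite \<times> 3) \<Rightarrow> real^'n \<Rightarrow> real^('p::finite \<times> 3)^('p::finite \<times> 3)" where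
  "BB \<Lambda>2 X b = block_diag (\<lambda>p. matrix (\<lambda>w. cross3 w (\<Lambda>2 (blk X p) *v b)))"

definition positions_in_domain :: "real^('p::finite \<times> 3) \<Rightarrow> bool" where
  "positions_in_domain X \<longleftrightarrow> (\<forall>p. blk X p \<in> logical_domain)"

section \<open>The splitting scheme\<close>

record ('p::finite, 'n1::finite, 'n2::finite) state =
  pos :: "real^('p::finite \<times> 3)"
  vel :: "real^('p::finite \<times> 3)"
  ecoef :: "real^('n1::finite \<times> 3)"
  bcoef :: "real^('n2::finite \<times> 3)"

definition update_E where
  "update_E F (\<Lambda>1 :: real^3 \<Rightarrow> real^('n1::finite \<times> 3)^3) (C :: real^('n1::finite \<times> 3)^('n2::finite \<times> 3)) \<omega> m q dt
     (s :: ('p::finite, 'n1::finite, 'n2::finite) state) (s' :: ('p::finite, 'n1::finite, 'n2::finite) state) \<longleftrightarrow>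
     pos s' = pos s \<and>
     vel s' = vel s + dt *\<^sub>R ((matrix_inv (Mm \<omega> m) ** Mq \<omega> q ** NN F (pos s) ** LL1 \<Lambda>1 (pos s)) *v ecoef s) \<and>
     ecoef s' = ecoef s \<and>
     bcoef s' = bcoef s - dt *\<^sub>R (C *v ecoef s)"

definition update_B where
  "update_B F (\<Lambda>1 :: real^3 \<Rightarrow> real^('n1::finite \<times> 3)^3) (\<Lambda>2 :: real^3 \<Rightarrow> real^('n2::finite \<times> 3)^3)
     (C :: real^('n1::finite \<times> 3)^('n2::finite \<times> 3)) dt
     (s :: ('p::finite, 'n1::finite, 'n2::finite) state) (s' :: ('p::finite, 'n1::finite, 'n2::finite) state) \<longleftrightarrow>
     pos s' = pos s \<and>
     vel s' = vel s \<and>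
     mass1 F \<Lambda>1 *v ecoef s' =
       mass1 F \<Lambda>1 *v ecoef s + dt *\<^sub>R ((transpose C ** mass2 F \<Lambda>2) *v bcoef s) \<and>
     bcoef s' = bcoef s"

text \<open>The particle update is implicit, so it is a relation. It holds for every solution whose
  new positions lie in the logical domain.\<close>

definition update_P where
  "update_P F (\<Lambda>1 :: real^3 \<Rightarrow> real^('n1::finite \<times> 3)^3) (\<Lambda>2 :: real^3 \<Rightarrow> real^('n2::finite \<times> 3)^3) \<omega> m q t dt
     (s :: ('p::finite, 'n1::finite, 'n2::finite) state) (s' :: ('p::finite, 'n1::finite, 'n2::finite) state) \<longleftrightarrow>
     (let Xbar = (1/2) *\<^sub>R (pos s + pos s');
          Vbar = (1/2) *\<^sub>R (vel s + vel s');
          X = (\<lambda>\<tau>. (1/dt) *\<^sub>R ((t + dt - \<tau>) *\<^sub>R pos s + (\<tau> - t) *\<^sub>R pos s'))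
      in positions_in_domain (pos s') \<and>
         pos s' = pos s + dt *\<^sub>R (transpose (NN F Xbar) *v Vbar) \<and>
         vel s' = vel s + dt *\<^sub>R ((matrix_inv (Mm \<omega> m) ** Mq \<omega> q ** NN F Xbar **
                    BB \<Lambda>2 Xbar (bcoef s) ** transpose (NN F Xbar)) *v Vbar) \<and>
         mass1 F \<Lambda>1 *v ecoef s' = mass1 F \<Lambda>1 *v ecoef s -
           (integral {t..t + dt} (\<lambda>\<tau>. transpose (LL1 \<Lambda>1 (X \<tau>))) **
              Mq \<omega> q ** transpose (NN F Xbar)) *v Vbar \<and>
         bcoef s' = bcoef s)"

text \<open>Every substep has its own step size; iterating \<open>substep\<close> covers all orders of composition.\<close>

definition substep where
  "substep F \<Lambda>1 \<Lambda>2 C \<omega> m q s s' \<longleftrightarrow>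
     (\<exists>t dt. dt > 0 \<and>
        (update_E F \<Lambda>1 C \<omega> m q dt s s' \<or>
         update_B F \<Lambda>1 \<Lambda>2 C dt s s' \<or>
         update_P F \<Lambda>1 \<Lambda>2 \<omega> m q t dt s s'))"

definition gauss_law where
  "gauss_law F (\<Lambda>0 :: real^3 \<Rightarrow> real^'n0^1) (\<Lambda>1 :: real^3 \<Rightarrow> real^('n1::finite \<times> 3)^3)
     (G :: real^'n0^('n1::finite \<times> 3)) \<omega> q (s :: ('p::finite, 'n1::finite, 'n2::finite) state) \<longleftrightarrow>
     (transpose G ** mass1 F \<Lambda>1) *v ecoef s =
       - ((transpose (LL0 \<Lambda>0 (pos s)) ** Mq0 \<omega> q) *v vec 1)"

end

theory Submission
  imports Defs
begin

text \<open>
  Gauss's law is an equation in the field coefficients \<open>e\<close> and the particle positions alone, so only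
  the updates (B) and (P) can affect it. In (B) the increment of \<open>M\<^sub>1 e\<close> lies in the range of \<open>C\<^sup>T\<close>,
  which \<open>G\<^sup>T\<close> annihilates because \<open>C G = 0\<close>: the discrete curl has no discrete divergence.

  In (P) the position update says that \<open>u = N\<^sup>T V\<close>, taken at the midpoints, is exactly the constant
  velocity of the straight trajectory \<open>X(\<tau>)\<close> joining the old and the new positions. Testing the
  deposited current with \<open>G\<close> and using \<open>\<nabla>\<Lambda>\<^sup>0 = \<Lambda>\<^sup>1 G\<close> turns it into the sum over the particles of
  \<open>\<omega>\<^sub>p q\<^sub>p \<nabla>\<Lambda>\<^sup>0(X\<^sub>p(\<tau>)) \<bullet> u\<^sub>p\<close>, which by the chain rule is the time derivative of the charge side
  \<open>L\<^sup>0(X(\<tau>))\<^sup>T M\<^sub>q\<^sup>0 1\<close>. The time integral in the current is therefore precisely the change of charge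
  over the step (lemma \<open>charge_deposition\<close>), and both sides of Gauss's law change by the same amount.
  A quadrature with an error would in general destroy this equality.

  The basis functions are differentiable only within the cube, so the trajectory has to stay inside.
  Since the cube is convex, it suffices that both end points lie in it; hence the invariant carried
  through the scheme is Gauss's law together with all positions being in the domain.
\<close>

section \<open>Differentiation along curves in the cube\<close>

lemma frechet_derivative_eq_grad_inner:
  fixes f :: "real^3 \<Rightarrow> real"
  assumes "f differentiable (at x within logical_domain)"
  shows "frechet_derivative f (at x within logical_domain) v = grad f x \<bullet> v"
proof -
  interpret D: linear "frechet_derivative f (at x within logical_domain)"
    using assms by (rule linear_frechet_derivative)
  have "frechet_derivative f (at x within logical_domain) v
      = frechet_derivative f (at x within logical_domain) (\<Sum>i\<in>UNIV. v $ i *s axis i 1)"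
    by (simp only: basis_expansion)
  also have "\<dots> = (\<Sum>i\<in>UNIV. v $ i * partial i f x)"
    by (simp add: D.sum D.scale partial_def scalar_mult_eq_scaleR del: vector_scaleR_component)
  also have "\<dots> = grad f x \<bullet> v"
    by (simp add: grad_def inner_vec_def mult.commute)
  finally show ?thesis .
qed

text \<open>The chain rule needs a derivative of \<open>f\<close> only within the image of the curve, so the one-sided
  derivatives on the faces of the cube cause no trouble even when the curve touches the boundary.\<close>

lemma has_vector_derivative_along_curve:
  fixes f :: "real^3 \<Rightarrow> real"
  assumes "f differentiable_on logical_domain"
    and "(\<gamma> has_vector_derivative v) (at \<tau> within T)"
    and "\<tau> \<in> T" and "\<gamma> ` T \<subseteq> logical_domain"
  shows "((\<lambda>\<tau>. f (\<gamma> \<tau>)) has_vector_derivative grad f (\<gamma> \<tau>) \<bullet> v) (at \<tau> within T)"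
proof -
  have diff: "f differentiable (at (\<gamma> \<tau>) within logical_domain)"
    using assms by (auto simp: differentiable_on_def)
  then have "(f has_derivative frechet_derivative f (at (\<gamma> \<tau>) within logical_domain))
      (at (\<gamma> \<tau>) within logical_domain)"
    by (simp add: frechet_derivative_works)
  then have "(f has_derivative frechet_derivative f (at (\<gamma> \<tau>) within logical_domain))
      (at (\<gamma> \<tau>) within \<gamma> ` T)"
    using assms(4) by (rule has_derivative_subset)
  from vector_derivative_diff_chain_within[OF assms(2) this]
  show ?thesis
    by (simp add: o_def frechet_derivative_eq_grad_inner[OF diff])
qed

section \<open>Particle matrices in components\<close>

lemma sum_particle_components:
  fixes g :: "'p::finite \<times> 3 \<Rightarrow> real"
  shows "(\<Sum>i\<in>UNIV. g i) = (\<Sum>p\<in>UNIV. \<Sum>k\<in>UNIV. g (p, k))"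
  by (simp add: sum.cartesian_product)

lemma Mq_mult_component: "(Mq \<omega> q *v u) $ (p, k) = \<omega> p * q p * u $ (p, k)"
proof -
  have "(Mq \<omega> q *v u) $ (p, k)
      = (\<Sum>r\<in>UNIV. \<Sum>l\<in>UNIV. (if p = r then \<omega> p * q p else 0) * (if k = l then 1 else 0) * u $ (r, l))"
    by (simp add: Mq_def kron_def diag_def mat_def matrix_vector_mult_def sum_particle_components
        cong: if_cong)
  also have "\<dots> = (\<Sum>r\<in>UNIV. if p = r then \<omega> p * q p * u $ (r, k) else 0)"
    by (intro sum.cong) (auto simp: mult.assoc sum_distrib_left[symmetric]
        if_distrib[of "\<lambda>x. x * _"] cong: if_cong)
  finally show ?thesis
    by simp
qed

lemma charge_component:
  "(transpose (LL0 \<Lambda>0 X) *v (Mq0 \<omega> q *v vec 1)) $ j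
    = (\<Sum>p\<in>UNIV. \<omega> p * q p * \<Lambda>0 (blk X p) $ 1 $ j)"
proof -
  have "Mq0 \<omega> q *v vec 1 = (\<chi> p. \<omega> p * q p)"
    by (simp add: vec_eq_iff Mq0_def diag_def matrix_vector_mult_def)
  then show ?thesis
    by (simp add: matrix_vector_mult_def transpose_def LL0_def mult.commute)
qed

text \<open>The column of \<open>\<Lambda>1 G\<close> is isolated as a vector because, inside a de Rham sequence, it is the
  gradient of the \<open>j\<close>-th scalar basis function.\<close>

lemma current_component:
  fixes G :: "real^'a^'c" and u :: "real^('b::finite \<times> 3)"
  shows "(transpose (LL1 \<Lambda>1 X ** G) *v (Mq \<omega> q *v u)) $ j
    = (\<Sum>p\<in>UNIV. \<omega> p * q p * ((\<chi> k. (\<Lambda>1 (blk X p) ** G) $ k $ j) \<bullet> blk u p))"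
proof -
  have "(transpose A *v w) $ j = (\<Sum>p\<in>UNIV. \<Sum>k\<in>UNIV. A $ (p, k) $ j * w $ (p, k))"
    for A :: "real^'a^('b \<times> 3)" and w
    by (simp add: matrix_vector_mult_def transpose_def sum_particle_components)
  then show ?thesis
    by (simp add: Mq_mult_component LL1_def matrix_matrix_mult_def blk_def inner_vec_def
        sum_distrib_left mult_ac)
qed

section \<open>Charge conservation along particle trajectories\<close>

lemma continuous_on_blk [continuous_intros]:
  "continuous_on T X \<Longrightarrow> continuous_on T (\<lambda>\<tau>. blk (X \<tau>) p)"
  unfolding blk_def by (intro continuous_intros)

lemma has_vector_derivative_blk:
  assumes "(X has_vector_derivative u) F"
  shows "((\<lambda>\<tau>. blk (X \<tau>) p) has_vector_derivative blk u p) F"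
proof -
  have "linear (\<lambda>X. blk X p)"
    by (rule linearI) (simp_all add: blk_def vec_eq_iff)
  then have "bounded_linear (\<lambda>X. blk X p)"
    by (simp add: linear_conv_bounded_linear)
  then show ?thesis
    using assms by (rule bounded_linear.has_vector_derivative)
qed

text \<open>A continuity equation integrated in time: the weak divergence of the current is the time
  derivative of the deposited charge, since \<open>\<Lambda>1 G\<close> is the gradient of \<open>\<Lambda>0\<close>.\<close>

lemma current_has_integral_charge_difference:
  fixes \<Lambda>0 :: "real^3 \<Rightarrow> real^'c^1" and X :: "real \<Rightarrow> real^('p::finite \<times> 3)"
  assumes "\<Lambda>0 differentiable_on logical_domain"
    and grad: "\<And>\<xi>. \<xi> \<in> logical_domain \<Longrightarrow> grad_cols \<Lambda>0 \<xi> = \<Lambda>1 \<xi> ** G"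
    and "a \<le> b"
    and deriv: "\<And>\<tau>. \<tau> \<in> {a..b} \<Longrightarrow> (X has_vector_derivative u) (at \<tau> within {a..b})"
    and inside: "\<And>\<tau>. \<tau> \<in> {a..b} \<Longrightarrow> positions_in_domain (X \<tau>)"
  shows "((\<lambda>\<tau>. (transpose (LL1 \<Lambda>1 (X \<tau>) ** G) *v (Mq \<omega> q *v u)) $ j) has_integral
      (transpose (LL0 \<Lambda>0 (X b)) *v (Mq0 \<omega> q *v vec 1)) $ j -
      (transpose (LL0 \<Lambda>0 (X a)) *v (Mq0 \<omega> q *v vec 1)) $ j) {a..b}"
proof (rule fundamental_theorem_of_calculus[OF \<open>a \<le> b\<close>])
  fix \<tau> assume \<tau>: "\<tau> \<in> {a..b}"
  have diff: "(\<lambda>\<xi>. \<Lambda>0 \<xi> $ 1 $ j) differentiable_on logical_domain"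
    using assms(1) unfolding differentiable_on_def differentiable_def
    by (fast intro: bounded_linear.has_derivative[OF bounded_linear_vec_nth])
  have "((\<lambda>\<tau>. \<Lambda>0 (blk (X \<tau>) p) $ 1 $ j) has_vector_derivative
      (\<chi> k. (\<Lambda>1 (blk (X \<tau>) p) ** G) $ k $ j) \<bullet> blk u p) (at \<tau> within {a..b})" for p
  proof -
    have "(\<lambda>\<tau>. blk (X \<tau>) p) ` {a..b} \<subseteq> logical_domain"
      using inside by (auto simp: positions_in_domain_def simp del: mem_box)
    from has_vector_derivative_along_curve[OF diff has_vector_derivative_blk[OF deriv[OF \<tau>]] \<tau> this]
    show ?thesis
      using grad[of "blk (X \<tau>) p"] inside[OF \<tau>]
      by (simp add: positions_in_domain_def grad_cols_def vec_eq_iff inner_vec_def)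
  qed
  then show "((\<lambda>\<tau>. (transpose (LL0 \<Lambda>0 (X \<tau>)) *v (Mq0 \<omega> q *v vec 1)) $ j) has_vector_derivative
      (transpose (LL1 \<Lambda>1 (X \<tau>) ** G) *v (Mq \<omega> q *v u)) $ j) (at \<tau> within {a..b})"
    unfolding charge_component current_component
    by (intro has_vector_derivative_sum bounded_linear.has_vector_derivative[OF bounded_linear_mult_right])
qed

text \<open>The integral in (P) is a Henstock-Kurzweil integral of a matrix function, with a default value
  for nonintegrable functions; integrability is what allows it to commute with linear maps.\<close>

lemma LL1_transpose_integrable:
  fixes \<Lambda>1 :: "real^3 \<Rightarrow> real^('n::finite)^3" and a b :: real
  assumes "continuous_on logical_domain \<Lambda>1" and "continuous_on {a..b} X"
    and "\<And>\<tau>. \<tau> \<in> {a..b} \<Longrightarrow> positions_in_domain (X \<tau>)"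
  shows "(\<lambda>\<tau>. transpose (LL1 \<Lambda>1 (X \<tau>))) integrable_on {a..b}"
proof (rule integrable_continuous_real)
  have "continuous_on {a..b} (\<lambda>\<tau>. \<Lambda>1 (blk (X \<tau>) p))" for p
    using assms
    by (intro continuous_on_compose2[OF assms(1)] continuous_intros)
       (auto simp: positions_in_domain_def simp del: mem_box)
  then show "continuous_on {a..b} (\<lambda>\<tau>. transpose (LL1 \<Lambda>1 (X \<tau>)))"
    unfolding transpose_def LL1_def by (simp add: continuous_intros)
qed

lemma matrix_vector_integral_component:
  fixes A :: "real \<Rightarrow> real^'n::finite^'m::finite" and B :: "real^'m^'l::finite"
  assumes "A integrable_on T"
  shows "(B *v (integral T A *v w)) $ j = integral T (\<lambda>\<tau>. (B *v (A \<tau> *v w)) $ j)"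
proof -
  have "linear (\<lambda>M :: real^'n^'m. (B *v (M *v w)) $ j)"
    by (rule linearI)
       (simp_all add: matrix_vector_mult_add_rdistrib matrix_vector_right_distrib
          scaleR_matrix_vector_assoc[symmetric] matrix_vector_mult_scaleR)
  then have "bounded_linear (\<lambda>M :: real^'n^'m. (B *v (M *v w)) $ j)"
    by (simp add: linear_conv_bounded_linear)
  from integral_linear[OF assms this] show ?thesis
    by (simp add: o_def)
qed

text \<open>The form in which charge conservation enters the particle update: there the time integral is
  taken of the matrix alone, and the constant factors are applied afterwards.\<close>

lemma charge_deposition:
  fixes X :: "real \<Rightarrow> real^('p::finite \<times> 3)"
  assumes "\<Lambda>0 differentiable_on logical_domain" and "continuous_on logical_domain \<Lambda>1"
    and "\<And>\<xi>. \<xi> \<in> logical_domain \<Longrightarrow> grad_cols \<Lambda>0 \<xi> = \<Lambda>1 \<xi> ** G"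
    and "a \<le> b"
    and deriv: "\<And>\<tau>. \<tau> \<in> {a..b} \<Longrightarrow> (X has_vector_derivative u) (at \<tau> within {a..b})"
    and "\<And>\<tau>. \<tau> \<in> {a..b} \<Longrightarrow> positions_in_domain (X \<tau>)"
  shows "transpose G *v (integral {a..b} (\<lambda>\<tau>. transpose (LL1 \<Lambda>1 (X \<tau>))) *v (Mq \<omega> q *v u))
      = transpose (LL0 \<Lambda>0 (X b)) *v (Mq0 \<omega> q *v vec 1) -
        transpose (LL0 \<Lambda>0 (X a)) *v (Mq0 \<omega> q *v vec 1)"
proof -
  have "continuous_on {a..b} X"
    using deriv by (rule continuous_on_vector_derivative)
  then have int: "(\<lambda>\<tau>. transpose (LL1 \<Lambda>1 (X \<tau>))) integrable_on {a..b}"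
    using assms by (intro LL1_transpose_integrable)
  show ?thesis
    unfolding vec_eq_iff matrix_vector_integral_component[OF int] vector_minus_component
      matrix_vector_mul_assoc[of "transpose G" "transpose _"] matrix_transpose_mul[symmetric]
    using assms by (intro allI integral_unique current_has_integral_charge_difference)
qed

section \<open>The substeps\<close>

text \<open>The trajectory is a convex combination of its end points, and the cube is convex.\<close>

lemma segment_positions_in_domain:
  fixes X X' :: "real^('p::finite \<times> 3)"
  assumes "positions_in_domain X" and "positions_in_domain X'" and "0 < dt" and "\<tau> \<in> {t..t + dt}"
  shows "positions_in_domain ((1/dt) *\<^sub>R ((t + dt - \<tau>) *\<^sub>R X + (\<tau> - t) *\<^sub>R X'))"
  unfolding positions_in_domain_def
proof
  fix p
  have "blk ((1/dt) *\<^sub>R ((t + dt - \<tau>) *\<^sub>R X + (\<tau> - t) *\<^sub>R X')) p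
      = ((t + dt - \<tau>) / dt) *\<^sub>R blk X p + ((\<tau> - t) / dt) *\<^sub>R blk X' p"
    by (simp add: blk_def vec_eq_iff field_simps)
  moreover have "\<dots> \<in> logical_domain"
    using assms
    by (intro convexD[OF convex_box(1)])
       (auto simp: positions_in_domain_def field_simps simp del: mem_box)
  ultimately show "blk ((1/dt) *\<^sub>R ((t + dt - \<tau>) *\<^sub>R X + (\<tau> - t) *\<^sub>R X')) p \<in> logical_domain"
    by simp
qed

text \<open>The same vector \<open>u\<close> moves the particles and carries the current; this is why the change of the
  field and the change of the charge match.\<close>

lemma gauss_law_update_P:
  assumes "\<Lambda>0 differentiable_on logical_domain" and "continuous_on logical_domain \<Lambda>1"
    and "\<And>\<xi>. \<xi> \<in> logical_domain \<Longrightarrow> grad_cols \<Lambda>0 \<xi> = \<Lambda>1 \<xi> ** G"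
    and "0 < dt" and "update_P F \<Lambda>1 \<Lambda>2 \<omega> m q t dt s s'"
    and "positions_in_domain (pos s)" and "gauss_law F \<Lambda>0 \<Lambda>1 G \<omega> q s"
  shows "gauss_law F \<Lambda>0 \<Lambda>1 G \<omega> q s'"
proof -
  define u where
    "u = transpose (NN F ((1/2) *\<^sub>R (pos s + pos s'))) *v ((1/2) *\<^sub>R (vel s + vel s'))"
  define X where "X = (\<lambda>\<tau>. (1/dt) *\<^sub>R ((t + dt - \<tau>) *\<^sub>R pos s + (\<tau> - t) *\<^sub>R pos s'))"
  from assms(5) have inside: "positions_in_domain (pos s')"
    and pos: "pos s' = pos s + dt *\<^sub>R u"
    and e: "mass1 F \<Lambda>1 *v ecoef s' = mass1 F \<Lambda>1 *v ecoef s -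
      integral {t..t + dt} (\<lambda>\<tau>. transpose (LL1 \<Lambda>1 (X \<tau>))) *v (Mq \<omega> q *v u)"
    unfolding update_P_def Let_def u_def X_def
    by (simp_all only: matrix_vector_mul_assoc matrix_mul_assoc)
  \<comment> \<open>This identification of \<open>u\<close> with the velocity of the trajectory is the consistency between the
     position update and the current deposition.\<close>
  have X_affine: "X = (\<lambda>\<tau>. pos s + (\<tau> - t) *\<^sub>R u)"
  proof
    fix \<tau>
    have "X \<tau> = (1/dt) *\<^sub>R (dt *\<^sub>R pos s + dt *\<^sub>R ((\<tau> - t) *\<^sub>R u))"
      unfolding X_def pos by (simp add: algebra_simps)
    also have "\<dots> = pos s + (\<tau> - t) *\<^sub>R u"
      using \<open>0 < dt\<close> by (simp add: scaleR_add_right)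
    finally show "X \<tau> = pos s + (\<tau> - t) *\<^sub>R u" .
  qed
  have "(X has_vector_derivative u) (at \<tau> within {t..t + dt})" for \<tau>
    unfolding X_affine by (auto intro!: derivative_eq_intros)
  moreover have "positions_in_domain (X \<tau>)" if "\<tau> \<in> {t..t + dt}" for \<tau>
    unfolding X_def using assms(6) inside \<open>0 < dt\<close> that by (rule segment_positions_in_domain)
  ultimately have "transpose G *v (integral {t..t + dt} (\<lambda>\<tau>. transpose (LL1 \<Lambda>1 (X \<tau>))) *v (Mq \<omega> q *v u))
      = transpose (LL0 \<Lambda>0 (X (t + dt))) *v (Mq0 \<omega> q *v vec 1) -
        transpose (LL0 \<Lambda>0 (X t)) *v (Mq0 \<omega> q *v vec 1)"
    using assms(1-4) by (intro charge_deposition) auto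
  moreover have "X t = pos s" and "X (t + dt) = pos s'"
    by (simp_all add: X_affine pos)
  ultimately show ?thesis
    using assms(7)
    by (simp add: gauss_law_def matrix_vector_mul_assoc[symmetric] e matrix_vector_mult_diff_distrib)
qed

lemma gauss_law_update_E:
  assumes "update_E F \<Lambda>1 C \<omega> m q dt s s'" and "gauss_law F \<Lambda>0 \<Lambda>1 G \<omega> q s"
  shows "gauss_law F \<Lambda>0 \<Lambda>1 G \<omega> q s'"
  using assms by (simp add: update_E_def gauss_law_def)

lemma gauss_law_update_B:
  assumes "C ** G = 0" and "update_B F \<Lambda>1 \<Lambda>2 C dt s s'" and "gauss_law F \<Lambda>0 \<Lambda>1 G \<omega> q s"
  shows "gauss_law F \<Lambda>0 \<Lambda>1 G \<omega> q s'"
proof -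
  have "transpose G ** transpose C = 0"
    unfolding matrix_transpose_mul[symmetric] assms(1) by (simp add: transpose_def vec_eq_iff)
  then have "transpose G *v (transpose C *v w) = 0" for w
    by (simp only: matrix_vector_mul_assoc matrix_vector_mult_0)
  then show ?thesis
    using assms(2,3)
    by (simp add: update_B_def gauss_law_def matrix_vector_mul_assoc[symmetric]
        matrix_vector_right_distrib matrix_vector_mult_scaleR)
qed

text \<open>The positions are part of the invariant because the next particle update needs its whole
  trajectory, including the starting point, inside the cube.\<close>

lemma substep_preserves_gauss_law:
  assumes "discrete_de_rham \<Lambda>0 \<Lambda>1 \<Lambda>2 \<Lambda>3 G C D" and "substep F \<Lambda>1 \<Lambda>2 C \<omega> m q s s'"
    and "positions_in_domain (pos s)" and "gauss_law F \<Lambda>0 \<Lambda>1 G \<omega> q s"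
  shows "positions_in_domain (pos s') \<and> gauss_law F \<Lambda>0 \<Lambda>1 G \<omega> q s'"
proof -
  from assms(1) have diff0: "\<Lambda>0 differentiable_on logical_domain"
    and cont1: "continuous_on logical_domain \<Lambda>1"
    and grad: "\<And>\<xi>. \<xi> \<in> logical_domain \<Longrightarrow> grad_cols \<Lambda>0 \<xi> = \<Lambda>1 \<xi> ** G"
    and CG: "C ** G = 0"
    by (auto simp: discrete_de_rham_def differentiable_imp_continuous_on simp del: mem_box)
  from assms(2) obtain t dt where "dt > 0" and
    "update_E F \<Lambda>1 C \<omega> m q dt s s' \<or> update_B F \<Lambda>1 \<Lambda>2 C dt s s' \<or>
     update_P F \<Lambda>1 \<Lambda>2 \<omega> m q t dt s s'"
    by (auto simp: substep_def)
  then consider (E) "update_E F \<Lambda>1 C \<omega> m q dt s s'" | (B) "update_B F \<Lambda>1 \<Lambda>2 C dt s s'"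
    | (P) "update_P F \<Lambda>1 \<Lambda>2 \<omega> m q t dt s s'"
    by blast
  then show ?thesis
  proof cases
    case E
    then show ?thesis
      using gauss_law_update_E[OF E assms(4)] assms(3) by (simp add: update_E_def)
  next
    case B
    then show ?thesis
      using gauss_law_update_B[OF CG B assms(4)] assms(3) by (simp add: update_B_def)
  next
    case P
    then show ?thesis
      using gauss_law_update_P[OF diff0 cont1 grad \<open>dt > 0\<close> P assms(3,4)]
      by (simp add: update_P_def Let_def)
  qed
qed

theorem proposition5p1:
  fixes F :: "real^3 \<Rightarrow> real^3" and \<Omega> :: "(real^3) set"
    and \<Lambda>0 :: "real^3 \<Rightarrow> real^'n0^1"
    and \<Lambda>1 :: "real^3 \<Rightarrow> real^('n1::finite \<times> 3)^3"
    and \<Lambda>2 :: "real^3 \<Rightarrow> real^('n2::finite \<times> 3)^3"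
    and \<Lambda>3 :: "real^3 \<Rightarrow> real^'n3^1"
    and G :: "real^'n0^('n1::finite \<times> 3)"
    and C :: "real^('n1::finite \<times> 3)^('n2::finite \<times> 3)"
    and D :: "real^('n2::finite \<times> 3)^'n3"
    and \<omega> m q :: "'p::finite \<Rightarrow> real"
    and s\<^sub>0 s :: "('p, 'n1, 'n2) state"
  assumes "coordinate_map F \<Omega>"
    and "discrete_de_rham \<Lambda>0 \<Lambda>1 \<Lambda>2 \<Lambda>3 G C D"
    and "\<And>p. \<omega> p > 0" and "\<And>p. m p > 0"
    and "positions_in_domain (pos s\<^sub>0)"
    and "(substep F \<Lambda>1 \<Lambda>2 C \<omega> m q)\<^sup>*\<^sup>* s\<^sub>0 s"
    and "gauss_law F \<Lambda>0 \<Lambda>1 G \<omega> q s\<^sub>0"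
  shows "gauss_law F \<Lambda>0 \<Lambda>1 G \<omega> q s"
proof -
  from assms(6) have "positions_in_domain (pos s) \<and> gauss_law F \<Lambda>0 \<Lambda>1 G \<omega> q s"
  proof (induction rule: rtranclp_induct)
    case base
    then show ?case
      using assms(5,7) by simp
  next
    case (step s s')
    then show ?case
      using substep_preserves_gauss_law[OF assms(2)] by blast
  qed
  then show ?thesis ..
qed

end
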